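(* For given $T>0$, let $f$ be an extremal equity strategy on $[0,T]$ with Lagrange multiplier $\nu$. Then $$\xi_s-f_s+2\nu h_s-2\nu\frac{\sigma_x}{\sigma_S}\int_0^s h_u e^{-\alpha(s-u)}\,du=0\qquad(0\le s\le T),$$ where $$h_u=f_u-\frac{\sigma_x}{\sigma_S}\int_u^T f_s e^{-\alpha(s-u)}\,ds\qquad(0\le u\le T).$$
   Context: Parameters: $\alpha,\bar x,x_0\in\mathbb{R}$ and $\sigma_x,\sigma_S>0$. Let $\xi_s=\frac1{\sigma_S}\left(\bar x+e^{-\alpha s}(x_0-\bar x)\right)$. An equity strategy is a continuous deterministic function $f:[0,T]\to\mathbb{R}$. Its mean and variance functionals are $$\mu_T[f]=\int_0^T\left(\xi_sf_s-\tfrac12 f_s^2\right)ds,\qquad \sigma_T^2[f]=\int_0^T\left[f_u-\frac{\sigma_x}{\sigma_S}\int_u^T f_se^{-\alpha(s-u)}ds\right]^2du .$$ An extremal equity strategy is a stationary point of the problem of extremizing $\mu_T[f]$ for a given value of $\sigma_T^2[f]$; that is, there is a real number $\nu$ (the Lagrange multiplier) such that for every continuous $\eta:[0,T]\to\mathbb{R}$, $\frac{d}{d\epsilon}\big|_{\epsilon=0}\left(\mu_T[f+\epsilon\eta]+\nu\,\sigma_T^2[f+\epsilon\eta]\right)=0$. *)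

theory Defs
  imports "HOL-Analysis.Analysis"
begin

text \<open>
  Strategies on \<open>[0,T]\<close> are represented by functions \<open>f :: real \<Rightarrow> real\<close> that are continuous
  on \<open>{0..T}\<close>; values of \<open>f\<close> outside \<open>{0..T}\<close> do not enter any of the notions below.
\<close>

definition xi :: "real \<Rightarrow> real \<Rightarrow> real \<Rightarrow> real \<Rightarrow> real \<Rightarrow> real" where
  "xi \<alpha> xbar x0 \<sigma>S s = (1 / \<sigma>S) * (xbar + exp (- \<alpha> * s) * (x0 - xbar))"

definition equity_strategy :: "real \<Rightarrow> (real \<Rightarrow> real) \<Rightarrow> bool" where
  "equity_strategy T f \<longleftrightarrow> continuous_on {0..T} f"

definition mean_functional ::
  "real \<Rightarrow> real \<Rightarrow> real \<Rightarrow> real \<Rightarrow> real \<Rightarrow> (real \<Rightarrow> real) \<Rightarrow> real" where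
  "mean_functional \<alpha> xbar x0 \<sigma>S T f =
     integral {0..T} (\<lambda>s. xi \<alpha> xbar x0 \<sigma>S s * f s - (1/2) * (f s)\<^sup>2)"

definition variance_functional ::
  "real \<Rightarrow> real \<Rightarrow> real \<Rightarrow> real \<Rightarrow> (real \<Rightarrow> real) \<Rightarrow> real" where
  "variance_functional \<alpha> \<sigma>x \<sigma>S T f =
     integral {0..T} (\<lambda>u.
       (f u - (\<sigma>x / \<sigma>S) * integral {u..T} (\<lambda>s. f s * exp (- \<alpha> * (s - u))))\<^sup>2)"

text \<open>
  Stationarity of the mean at a given variance, with Lagrange multiplier \<open>\<nu>\<close>; an extremal
  equity strategy is one for which such a \<open>\<nu>\<close> exists.  The condition asserts that each
  directional derivative exists and vanishes.
\<close>

definition extremal_with_multiplier ::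
  "real \<Rightarrow> real \<Rightarrow> real \<Rightarrow> real \<Rightarrow> real \<Rightarrow> real \<Rightarrow> (real \<Rightarrow> real) \<Rightarrow> real \<Rightarrow> bool" where
  "extremal_with_multiplier \<alpha> xbar x0 \<sigma>x \<sigma>S T f \<nu> \<longleftrightarrow>
     equity_strategy T f \<and>
     (\<forall>\<eta>. continuous_on {0..T} \<eta> \<longrightarrow>
        ((\<lambda>\<epsilon>. mean_functional \<alpha> xbar x0 \<sigma>S T (\<lambda>s. f s + \<epsilon> * \<eta> s)
              + \<nu> * variance_functional \<alpha> \<sigma>x \<sigma>S T (\<lambda>s. f s + \<epsilon> * \<eta> s))
          has_real_derivative 0) (at 0))"

end

theory Submission
  imports Defs
begin

text \<open>
  Along a line \<open>f + \<epsilon> \<eta>\<close> both functionals are quadratic polynomials in \<open>\<epsilon>\<close>. Transposing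
  the Volterra operator \<open>\<eta> \<mapsto> \<integral>\<^sub>u\<^sup>T \<eta> s exp (- \<alpha> (s - u)) ds\<close> brings the linear coefficient
  into the form \<open>\<integral> \<phi> \<eta>\<close>, where \<open>\<phi>\<close> is the continuous function claimed to vanish. Testing
  with \<open>\<eta> = \<phi>\<close> gives \<open>\<integral> \<phi>\<^sup>2 = 0\<close>.
\<close>

text \<open>Since the exponent is additive, the kernel splits into a function of \<open>u\<close>
  and a function of \<open>s\<close>. What remains depends on \<open>u\<close> only through the
  lower limit, so standard facts on indefinite integrals give continuity and derivatives without
  treating a parameter integral.\<close>

lemma exp_tail_factor:
  fixes \<alpha> u T :: real and f :: "real \<Rightarrow> real"
  shows "integral {u..T} (\<lambda>s. f s * exp (- \<alpha> * (s - u)))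
    = exp (\<alpha> * u) * integral {u..T} (\<lambda>s. f s * exp (- \<alpha> * s))"
proof -
  have "(\<lambda>s. f s * exp (- \<alpha> * (s - u))) = (\<lambda>s. exp (\<alpha> * u) * (f s * exp (- \<alpha> * s)))"
    by (auto simp: exp_add[symmetric] algebra_simps)
  then show ?thesis by simp
qed

lemma exp_initial_factor:
  fixes \<alpha> s :: real and h :: "real \<Rightarrow> real"
  shows "integral {0..s} (\<lambda>u. h u * exp (- \<alpha> * (s - u)))
    = exp (- \<alpha> * s) * integral {0..s} (\<lambda>u. h u * exp (\<alpha> * u))"
proof -
  have "(\<lambda>u. h u * exp (- \<alpha> * (s - u))) = (\<lambda>u. exp (- \<alpha> * s) * (h u * exp (\<alpha> * u)))"
    by (auto simp: exp_add[symmetric] algebra_simps)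
  then show ?thesis by simp
qed

lemma continuous_on_exp_tail:
  fixes f :: "real \<Rightarrow> real"
  assumes "continuous_on {0..T} f"
  shows "continuous_on {0..T} (\<lambda>u. integral {u..T} (\<lambda>s. f s * exp (- \<alpha> * (s - u))))"
  unfolding exp_tail_factor
  by (intro continuous_intros indefinite_integral_continuous_1' integrable_continuous_interval assms)

lemma continuous_on_exp_initial:
  fixes h :: "real \<Rightarrow> real"
  assumes "continuous_on {0..T} h"
  shows "continuous_on {0..T} (\<lambda>s. integral {0..s} (\<lambda>u. h u * exp (- \<alpha> * (s - u))))"
  unfolding exp_initial_factor
  by (intro continuous_intros indefinite_integral_continuous_1 integrable_continuous_interval assms)

text \<open>This is Fubini on the triangle \<open>0 \<le> u \<le> s \<le> T\<close>, obtained here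
  by integration by parts. The factored kernel makes \<open>H\<close> and \<open>E\<close>
  antiderivatives, up to sign, of the two weighted functions.\<close>

lemma exp_tail_adjoint:
  fixes h \<eta> :: "real \<Rightarrow> real"
  assumes "0 \<le> T" and h: "continuous_on {0..T} h" and \<eta>: "continuous_on {0..T} \<eta>"
  shows "integral {0..T} (\<lambda>u. h u * integral {u..T} (\<lambda>s. \<eta> s * exp (- \<alpha> * (s - u))))
    = integral {0..T} (\<lambda>s. \<eta> s * integral {0..s} (\<lambda>u. h u * exp (- \<alpha> * (s - u))))"
proof -
  define H where "H u = integral {0..u} (\<lambda>w. h w * exp (\<alpha> * w))" for u
  define E where "E u = integral {u..T} (\<lambda>s. \<eta> s * exp (- \<alpha> * s))" for u
  have H': "(H has_real_derivative h u * exp (\<alpha> * u)) (at u within {0..T})"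
    if "u \<in> {0..T}" for u
    unfolding H_def by (intro integral_has_real_derivative that continuous_intros h)
  have E': "(E has_real_derivative - (\<eta> u * exp (- \<alpha> * u))) (at u within {0..T})"
    if "u \<in> {0..T}" for u
    unfolding E_def by (intro integral_has_real_derivative' that continuous_intros \<eta>)
  note cont = DERIV_continuous_on[OF H'] DERIV_continuous_on[OF E']
  \<comment> \<open>The integrand is the derivative of the product of \<open>H\<close> and
    \<open>E\<close>. Both boundary terms will vanish, because \<open>H\<close> starts at 0 and
    \<open>E\<close> ends at 0.\<close>
  have "((\<lambda>u. h u * exp (\<alpha> * u) * E u + - (\<eta> u * exp (- \<alpha> * u)) * H u)
      has_integral H T * E T - H 0 * E 0) {0..T}"
    by (intro fundamental_theorem_of_calculus \<open>0 \<le> T\<close>)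
      (simp only: has_real_derivative_iff_has_vector_derivative[symmetric], intro DERIV_mult H' E')
  moreover have "H 0 = 0" "E T = 0" by (auto simp: H_def E_def)
  ultimately have "integral {0..T} (\<lambda>u. h u * exp (\<alpha> * u) * E u - \<eta> u * exp (- \<alpha> * u) * H u) = 0"
    by (auto dest: integral_unique)
  moreover have "integral {0..T} (\<lambda>u. h u * exp (\<alpha> * u) * E u - \<eta> u * exp (- \<alpha> * u) * H u)
    = integral {0..T} (\<lambda>u. h u * exp (\<alpha> * u) * E u)
      - integral {0..T} (\<lambda>u. \<eta> u * exp (- \<alpha> * u) * H u)"
    by (intro Henstock_Kurzweil_Integration.integral_diff integrable_continuous_interval
        continuous_intros h \<eta> cont)
  ultimately show ?thesis
    unfolding exp_tail_factor exp_initial_factor H_def E_def by (simp add: mult.assoc)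
qed

text \<open>The integral is itself a quadratic polynomial in \<epsilon>, so its derivative at 0 is
  the linear coefficient. Both functionals are reduced to this shape, which avoids differentiating
  under the integral sign.\<close>

lemma integral_quadratic_derivative_0:
  fixes a b c :: "real \<Rightarrow> real"
  assumes "continuous_on {0..T} a" "continuous_on {0..T} b" "continuous_on {0..T} c"
  shows "((\<lambda>\<epsilon>. integral {0..T} (\<lambda>s. a s + \<epsilon> * b s + \<epsilon>\<^sup>2 * c s))
    has_real_derivative integral {0..T} b) (at 0)"
proof -
  note [simp] = integrable_continuous_interval[OF assms(1)]
    integrable_continuous_interval[OF assms(2)] integrable_continuous_interval[OF assms(3)]
  have "integral {0..T} (\<lambda>s. a s + \<epsilon> * b s + \<epsilon>\<^sup>2 * c s)
    = integral {0..T} a + \<epsilon> * integral {0..T} b + \<epsilon>\<^sup>2 * integral {0..T} c" for \<epsilon>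
    by (simp add: Henstock_Kurzweil_Integration.integral_add integrable_add
        integrable_on_mult_right)
  then show ?thesis
    by (auto intro!: derivative_eq_intros)
qed

lemma continuous_on_xi: "continuous_on A (xi \<alpha> xbar x0 \<sigma>S)"
  unfolding xi_def by (intro continuous_intros)

lemma mean_functional_derivative:
  assumes f: "continuous_on {0..T} f" and \<eta>: "continuous_on {0..T} \<eta>"
  shows "((\<lambda>\<epsilon>. mean_functional \<alpha> xbar x0 \<sigma>S T (\<lambda>s. f s + \<epsilon> * \<eta> s))
    has_real_derivative integral {0..T} (\<lambda>s. (xi \<alpha> xbar x0 \<sigma>S s - f s) * \<eta> s)) (at 0)"
proof -
  let ?x = "xi \<alpha> xbar x0 \<sigma>S"
  have "((\<lambda>\<epsilon>. integral {0..T} (\<lambda>s. (?x s * f s - (1/2) * (f s)\<^sup>2)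
        + \<epsilon> * ((?x s - f s) * \<eta> s) + \<epsilon>\<^sup>2 * (- (1/2) * (\<eta> s)\<^sup>2)))
    has_real_derivative integral {0..T} (\<lambda>s. (?x s - f s) * \<eta> s)) (at 0)"
    by (intro integral_quadratic_derivative_0 continuous_intros continuous_on_xi f \<eta>)
  moreover have "?x s * (f s + \<epsilon> * \<eta> s) - (1/2) * (f s + \<epsilon> * \<eta> s)\<^sup>2
      = (?x s * f s - (1/2) * (f s)\<^sup>2) + \<epsilon> * ((?x s - f s) * \<eta> s) + \<epsilon>\<^sup>2 * (- (1/2) * (\<eta> s)\<^sup>2)"
    for s \<epsilon>
    by (simp add: power2_eq_square field_simps)
  ultimately show ?thesis
    unfolding mean_functional_def by simp
qed

text \<open>The operator \<open>G\<close> is linear, so the squared integrand along the line is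
  quadratic in \<epsilon>, and its cross term supplies the derivative.\<close>

lemma variance_functional_derivative:
  fixes \<alpha> \<sigma>x \<sigma>S T :: real and f \<eta> :: "real \<Rightarrow> real"
  defines "G \<equiv> \<lambda>f u. f u - (\<sigma>x / \<sigma>S) * integral {u..T} (\<lambda>s. f s * exp (- \<alpha> * (s - u)))"
  assumes f: "continuous_on {0..T} f" and \<eta>: "continuous_on {0..T} \<eta>"
  shows "((\<lambda>\<epsilon>. variance_functional \<alpha> \<sigma>x \<sigma>S T (\<lambda>s. f s + \<epsilon> * \<eta> s))
    has_real_derivative integral {0..T} (\<lambda>u. 2 * (G f u * G \<eta> u))) (at 0)"
proof -
  have cont: "continuous_on {0..T} (G g)" if "continuous_on {0..T} g" for g
    unfolding G_def by (intro continuous_intros continuous_on_exp_tail that)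
  \<comment> \<open>For \<open>u\<close> in \<open>{0..T}\<close> the range \<open>{u..T}\<close>
    lies where both functions are continuous, so both integrals exist and additivity
    applies.\<close>
  have G_line: "G (\<lambda>s. f s + \<epsilon> * \<eta> s) u = G f u + \<epsilon> * G \<eta> u" if "u \<in> {0..T}" for u \<epsilon>
  proof -
    have int: "(\<lambda>s. g s * exp (- \<alpha> * (s - u))) integrable_on {u..T}"
      if "continuous_on {0..T} g" for g :: "real \<Rightarrow> real"
      using \<open>u \<in> {0..T}\<close>
      by (intro integrable_continuous_interval continuous_intros continuous_on_subset[OF that]) auto
    have "integral {u..T} (\<lambda>s. (f s + \<epsilon> * \<eta> s) * exp (- \<alpha> * (s - u)))
      = integral {u..T} (\<lambda>s. f s * exp (- \<alpha> * (s - u)) + \<epsilon> * (\<eta> s * exp (- \<alpha> * (s - u))))"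
      by (simp add: algebra_simps)
    also have "\<dots> = integral {u..T} (\<lambda>s. f s * exp (- \<alpha> * (s - u)))
      + \<epsilon> * integral {u..T} (\<lambda>s. \<eta> s * exp (- \<alpha> * (s - u)))"
      by (subst Henstock_Kurzweil_Integration.integral_add)
        (auto intro!: int[OF f, simplified] int[OF \<eta>, simplified] integrable_on_mult_right)
    finally show ?thesis
      unfolding G_def by (simp add: algebra_simps)
  qed
  have "variance_functional \<alpha> \<sigma>x \<sigma>S T (\<lambda>s. f s + \<epsilon> * \<eta> s)
    = integral {0..T} (\<lambda>u. (G f u)\<^sup>2 + \<epsilon> * (2 * (G f u * G \<eta> u)) + \<epsilon>\<^sup>2 * (G \<eta> u)\<^sup>2)" for \<epsilon>
  proof -
    have "variance_functional \<alpha> \<sigma>x \<sigma>S T (\<lambda>s. f s + \<epsilon> * \<eta> s)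
      = integral {0..T} (\<lambda>u. (G (\<lambda>s. f s + \<epsilon> * \<eta> s) u)\<^sup>2)"
      unfolding variance_functional_def G_def ..
    also have "\<dots> = integral {0..T}
        (\<lambda>u. (G f u)\<^sup>2 + \<epsilon> * (2 * (G f u * G \<eta> u)) + \<epsilon>\<^sup>2 * (G \<eta> u)\<^sup>2)"
      by (intro integral_cong) (simp add: G_line power2_eq_square algebra_simps)
    finally show ?thesis .
  qed
  then show ?thesis
    by (simp only:)
      (intro integral_quadratic_derivative_0 continuous_intros cont f \<eta>)
qed

theorem lemma3p3:
  fixes \<alpha> xbar x0 \<sigma>x \<sigma>S T \<nu> :: real and f h :: "real \<Rightarrow> real"
  assumes "\<sigma>x > 0" and "\<sigma>S > 0" and "T > 0"
    and "extremal_with_multiplier \<alpha> xbar x0 \<sigma>x \<sigma>S T f \<nu>"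
    and "\<And>u. u \<in> {0..T} \<Longrightarrow>
      h u = f u - (\<sigma>x / \<sigma>S) * integral {u..T} (\<lambda>s. f s * exp (- \<alpha> * (s - u)))"
  shows "\<forall>s\<in>{0..T}.
    xi \<alpha> xbar x0 \<sigma>S s - f s + 2 * \<nu> * h s
      - 2 * \<nu> * (\<sigma>x / \<sigma>S) * integral {0..s} (\<lambda>u. h u * exp (- \<alpha> * (s - u))) = 0"
proof -
  define k where "k = \<sigma>x / \<sigma>S"
  define K where "K g u = integral {u..T} (\<lambda>s. g s * exp (- \<alpha> * (s - u)))"
    for g :: "real \<Rightarrow> real" and u
  \<comment> \<open>\<open>L\<close> is the transpose of the operator \<open>K\<close>, applied to
    \<open>h\<close>.\<close>
  define L where "L s = integral {0..s} (\<lambda>u. h u * exp (- \<alpha> * (s - u)))" for s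
  define \<phi> where "\<phi> s = xi \<alpha> xbar x0 \<sigma>S s - f s + 2 * \<nu> * h s - 2 * \<nu> * k * L s" for s
  have f: "continuous_on {0..T} f"
    using assms(4) by (simp add: extremal_with_multiplier_def equity_strategy_def)
  have h_eq: "h u = f u - k * K f u" if "u \<in> {0..T}" for u
    using assms(5)[OF that] by (simp add: k_def K_def)
  \<comment> \<open>The values of \<open>h\<close> are prescribed only on \<open>{0..T}\<close>, so
    continuity is shown for the formula and then carried over to \<open>h\<close>.\<close>
  have "continuous_on {0..T} (\<lambda>u. f u - k * K f u)"
    unfolding K_def by (intro continuous_intros continuous_on_exp_tail f)
  then have h: "continuous_on {0..T} h"
    by (rule continuous_on_eq) (simp add: h_eq)
  have L: "continuous_on {0..T} L"
    unfolding L_def by (intro continuous_on_exp_initial h)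
  have \<phi>: "continuous_on {0..T} \<phi>"
    unfolding \<phi>_def by (intro continuous_intros continuous_on_xi f h L)
  have K: "continuous_on {0..T} (K \<phi>)"
    unfolding K_def by (intro continuous_on_exp_tail \<phi>)
  let ?x = "xi \<alpha> xbar x0 \<sigma>S"
  note int = integrable_continuous_interval continuous_intros f h L \<phi> K continuous_on_xi
  have "integral {0..T} (\<lambda>s. (?x s - f s) * \<phi> s)
      + \<nu> * integral {0..T} (\<lambda>u. 2 * ((f u - k * K f u) * (\<phi> u - k * K \<phi> u))) = 0"
  \<comment> \<open>The left side is the computed derivative of \<open>?F\<close> at 0, and
    stationarity in the direction \<phi> says that this derivative is 0.\<close>
  proof (rule DERIV_unique)
    let ?F = "\<lambda>\<epsilon>. mean_functional \<alpha> xbar x0 \<sigma>S T (\<lambda>s. f s + \<epsilon> * \<phi> s)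
        + \<nu> * variance_functional \<alpha> \<sigma>x \<sigma>S T (\<lambda>s. f s + \<epsilon> * \<phi> s)"
    show "(?F has_real_derivative integral {0..T} (\<lambda>s. (?x s - f s) * \<phi> s)
      + \<nu> * integral {0..T} (\<lambda>u. 2 * ((f u - k * K f u) * (\<phi> u - k * K \<phi> u)))) (at 0)"
      unfolding k_def K_def
      by (intro DERIV_add DERIV_cmult mean_functional_derivative variance_functional_derivative f \<phi>)
    show "(?F has_real_derivative 0) (at 0)"
      using assms(4) \<phi> by (simp add: extremal_with_multiplier_def)
  qed
  also have "integral {0..T} (\<lambda>u. 2 * ((f u - k * K f u) * (\<phi> u - k * K \<phi> u)))
    = integral {0..T} (\<lambda>u. 2 * (h u * \<phi> u) - 2 * k * (h u * K \<phi> u))"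
    by (intro integral_cong) (simp add: h_eq algebra_simps)
  also have "\<dots> = integral {0..T} (\<lambda>u. 2 * (h u * \<phi> u)) - 2 * k * integral {0..T} (\<lambda>u. h u * K \<phi> u)"
    by (subst Henstock_Kurzweil_Integration.integral_diff)
      (auto intro!: int)
  \<comment> \<open>Transposition frees \<phi> from the integral operator, so that \<phi> becomes a
    common factor of all terms.\<close>
  also have "integral {0..T} (\<lambda>u. h u * K \<phi> u) = integral {0..T} (\<lambda>s. \<phi> s * L s)"
    unfolding K_def L_def using \<open>T > 0\<close> by (intro exp_tail_adjoint h \<phi>) simp
  finally have "integral {0..T} (\<lambda>s. (?x s - f s) * \<phi> s)
    + \<nu> * (2 * integral {0..T} (\<lambda>u. h u * \<phi> u) - 2 * k * integral {0..T} (\<lambda>s. \<phi> s * L s)) = 0"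
    by simp
  moreover have "((\<lambda>s. (?x s - f s) * \<phi> s + \<nu> * (2 * (h s * \<phi> s) - 2 * k * (\<phi> s * L s)))
    has_integral integral {0..T} (\<lambda>s. (?x s - f s) * \<phi> s)
    + \<nu> * (2 * integral {0..T} (\<lambda>u. h u * \<phi> u) - 2 * k * integral {0..T} (\<lambda>s. \<phi> s * L s))) {0..T}"
    by (intro has_integral_add has_integral_mult_right has_integral_diff integrable_integral int)
  \<comment> \<open>Factoring out \<phi> leaves exactly the expression that defines \<phi>.\<close>
  moreover have "(\<lambda>s. (?x s - f s) * \<phi> s + \<nu> * (2 * (h s * \<phi> s) - 2 * k * (\<phi> s * L s)))
    = (\<lambda>s. (\<phi> s)\<^sup>2)"
    by (simp add: \<phi>_def power2_eq_square algebra_simps)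
  ultimately have "integral {0..T} (\<lambda>s. (\<phi> s)\<^sup>2) = 0"
    by (simp add: integral_unique)
  moreover have "continuous_on {0..T} (\<lambda>s. (\<phi> s)\<^sup>2)"
    by (intro continuous_intros \<phi>)
  \<comment> \<open>A continuous nonnegative function with integral 0 vanishes on an interval of
    positive length; on a single point the integral would give no information.\<close>
  ultimately have "\<forall>s\<in>{0..T}. (\<phi> s)\<^sup>2 = 0"
    using integral_eq_0_iff \<open>T > 0\<close> by force
  then show ?thesis
    by (simp add: \<phi>_def k_def L_def)
qed

end
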